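(* For every graph $G$, $\rho_e^o(G)=\alpha(A_G)$, where $A_G$ is the oriented star-conflict graph of $G$.
   Context: All graphs are finite, simple and undirected; $\alpha$ denotes the independence number. Two distinct edges $e_1,e_2\in E(G)$ have a common edge if there is an edge $e\in E(G)\setminus\{e_1,e_2\}$ joining an endpoint of $e_1$ to an endpoint of $e_2$. A set $D\subseteq E(G)$ is an edge open packing if no two edges of $D$ have a common edge. The edge open packing number $\rho_e^o(G)$ is the maximum cardinality of an edge open packing of $G$. The oriented star-conflict graph $A_G$ has vertex set $V(A_G)=\{(c,\ell): c\ell\in E(G)\}$, the set of ordered edges of $G$ (each edge gives two ordered edges). Two distinct ordered edges $(c,\ell)$ and $(d,r)$ are compatible if either (same centre) $c=d$, $\ell\ne r$ and $\ell r\notin E(G)$; or (different centres) $c\neq d$, the four vertices $c,\ell,d,r$ are distinct, and $cd,cr,\ell d,\ell r\notin E(G)$. Two distinct vertices of $A_G$ are adjacent if and only if the corresponding ordered edges are not compatible. *)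

theory Defs
  imports Main "HOL-Library.Ramsey"
begin

locale simple_graph =
  fixes V :: "'a set" and E :: "'a set set"
  assumes finite_V: "finite V"
    and edges: "E \<subseteq> [V]\<^bsup>2\<^esup>"
begin

lemma finite_E: "finite E"
  using finite_V edges by (meson finite_imp_finite_nsets finite_subset)

end

text \<open>\<^const>\<open>indep\<close> takes the vertex subset first and the edge set second.\<close>

definition independence_number :: "'a set \<Rightarrow> 'a set set \<Rightarrow> nat" where
  "independence_number V E = Max {card S | S. S \<subseteq> V \<and> indep S E}"

definition have_common_edge :: "'a set set \<Rightarrow> 'a set \<Rightarrow> 'a set \<Rightarrow> bool" where
  "have_common_edge E e\<^sub>1 e\<^sub>2 \<longleftrightarrow> (\<exists>e \<in> E - {e\<^sub>1, e\<^sub>2}. \<exists>u \<in> e\<^sub>1. \<exists>v \<in> e\<^sub>2. e = {u, v})"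

definition edge_open_packing :: "'a set set \<Rightarrow> 'a set set \<Rightarrow> bool" where
  "edge_open_packing E D \<longleftrightarrow>
     D \<subseteq> E \<and> (\<forall>e\<^sub>1 \<in> D. \<forall>e\<^sub>2 \<in> D. e\<^sub>1 \<noteq> e\<^sub>2 \<longrightarrow> \<not> have_common_edge E e\<^sub>1 e\<^sub>2)"

definition edge_open_packing_number :: "'a set set \<Rightarrow> nat" where
  "edge_open_packing_number E = Max {card D | D. edge_open_packing E D}"

definition compatible :: "'a set set \<Rightarrow> 'a \<times> 'a \<Rightarrow> 'a \<times> 'a \<Rightarrow> bool" where
  "compatible E = (\<lambda>(c, l) (d, r).
     (c = d \<and> l \<noteq> r \<and> {l, r} \<notin> E) \<or>
     (c \<noteq> d \<and> distinct [c, l, d, r] \<and>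
      {c, d} \<notin> E \<and> {c, r} \<notin> E \<and> {l, d} \<notin> E \<and> {l, r} \<notin> E))"

definition star_conflict_verts :: "'a set set \<Rightarrow> ('a \<times> 'a) set" where
  "star_conflict_verts E = {(c, l). {c, l} \<in> E}"

definition star_conflict_edges :: "'a set set \<Rightarrow> ('a \<times> 'a) set set" where
  "star_conflict_edges E =
     {{x, y} | x y. x \<in> star_conflict_verts E \<and> y \<in> star_conflict_verts E \<and>
                    x \<noteq> y \<and> \<not> compatible E x y}"

lemma compatible_sym: "compatible E x y \<longleftrightarrow> compatible E y x"
  by (cases x; cases y) (auto simp: compatible_def insert_commute)

context simple_graph
begin

lemma star_conflict_simple_graph:
  "simple_graph (star_conflict_verts E) (star_conflict_edges E)"
proof
  have "star_conflict_verts E \<subseteq> V \<times> V"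
    using edges by (auto simp: star_conflict_verts_def nsets_def)
  then show "finite (star_conflict_verts E)"
    using finite_V by (meson finite_SigmaI finite_subset)
  show "star_conflict_edges E \<subseteq> [star_conflict_verts E]\<^bsup>2\<^esup>"
    by (auto simp: star_conflict_edges_def nsets_def)
qed

text \<open>The sets whose maxima are taken are finite and nonempty, so both maxima are attained.\<close>

lemma independent_cards: 
  "finite {card S | S. S \<subseteq> V \<and> indep S E}" "{card S | S. S \<subseteq> V \<and> indep S E} \<noteq> {}"
proof -
  show "finite {card S | S. S \<subseteq> V \<and> indep S E}"
    using finite_V by simp
  have "{} \<subseteq> V \<and> indep {} E" by simp
  then show "{card S | S. S \<subseteq> V \<and> indep S E} \<noteq> {}" by blast
qed

lemma edge_open_packing_cards:
  "finite {card D | D. edge_open_packing E D}" "{card D | D. edge_open_packing E D} \<noteq> {}"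
proof -
  have "{D. edge_open_packing E D} \<subseteq> Pow E"
    by (auto simp: edge_open_packing_def)
  then have "finite {D. edge_open_packing E D}"
    using finite_E by (meson finite_Pow_iff finite_subset)
  then show "finite {card D | D. edge_open_packing E D}" by simp
  have "edge_open_packing E {}" by (simp add: edge_open_packing_def)
  then show "{card D | D. edge_open_packing E D} \<noteq> {}" by blast
qed

end

end

theory Submission
  imports Defs
begin

text \<open>Forgetting the orientation maps an independent set of the star-conflict graph injectively to an
  edge open packing. Conversely, an edge of an edge open packing cannot meet other packing edges at
  both of its endpoints, since it would then be a common edge of two of them. So every packing edge
  has an endpoint that lies on no other packing edge, and orienting each edge towards such a leaf
  gives pairwise compatible ordered edges.\<close>

context simple_graph
begin

lemma edgeD: "{u, v} \<in> E \<Longrightarrow> u \<noteq> v"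
  using edges by (auto simp: nsets_def)

lemma edgeE:
  assumes "e \<in> E"
  obtains u v where "e = {u, v}" "u \<noteq> v"
  using assms edges by (auto simp: nsets_def card_2_iff)

lemma indep_star_conflict_iff:
  assumes "S \<subseteq> star_conflict_verts E"
  shows "indep S (star_conflict_edges E) \<longleftrightarrow>
    (\<forall>x \<in> S. \<forall>y \<in> S. x \<noteq> y \<longrightarrow> compatible E x y)"
proof -
  have "{x, y} \<in> star_conflict_edges E \<longleftrightarrow> \<not> compatible E x y"
    if "x \<in> S" "y \<in> S" "x \<noteq> y" for x y
  proof
    assume "{x, y} \<in> star_conflict_edges E"
    \<comment> \<open>The pair is unordered, so \<open>(x', y')\<close> may be
      \<open>(y, x)\<close>; symmetry of \<open>compatible\<close> covers that case.\<close>
    then obtain x' y' where "{x, y} = {x', y'}" "\<not> compatible E x' y'"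
      unfolding star_conflict_edges_def by blast
    then show "\<not> compatible E x y"
      using compatible_sym[of E x y] by (metis doubleton_eq_iff)
  next
    assume "\<not> compatible E x y"
    then show "{x, y} \<in> star_conflict_edges E"
      using that assms unfolding star_conflict_edges_def by blast
  qed
  then show ?thesis
    by (auto simp: indep_def)
qed

text \<open>For a shared centre, the only pairs across the two edges are \<open>{c, c}\<close>,
  which is no edge by looplessness, the two edges themselves, and \<open>{l, r}\<close>. For
  different centres, \<open>compatible\<close> forbids all four cross pairs.\<close>

lemma compatible_no_common_edge:
  assumes "compatible E (c, l) (d, r)"
  shows "\<not> have_common_edge E {c, l} {d, r}"
  using assms edgeD by (auto simp: compatible_def have_common_edge_def insert_commute)

text \<open>Source of injectivity when orientations are forgotten: \<open>(c, l)\<close> and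
  \<open>(l, c)\<close> always conflict, so an independent set contains at most one of them.\<close>

lemma compatible_imp_distinct_edges: "compatible E (c, l) (d, r) \<Longrightarrow> {c, l} \<noteq> {d, r}"
  by (auto simp: compatible_def doubleton_eq_iff)

lemma indep_imp_packing:
  assumes S: "S \<subseteq> star_conflict_verts E" and indep: "indep S (star_conflict_edges E)"
  obtains D where "edge_open_packing E D" "card D = card S"
proof
  let ?f = "\<lambda>(c, l). {c, l}"
  have comp: "compatible E x y" if "x \<in> S" "y \<in> S" "x \<noteq> y" for x y
    using that indep indep_star_conflict_iff[OF S] by blast
  have "inj_on ?f S"
  proof (rule inj_onI, rule ccontr)
    fix x y assume xy: "x \<in> S" "y \<in> S" "?f x = ?f y" "x \<noteq> y"
    obtain c l d r where "x = (c, l)" "y = (d, r)"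
      by (cases x, cases y)
    with xy show False
      using comp[of x y] compatible_imp_distinct_edges[of c l d r] by simp
  qed
  then show "card (?f ` S) = card S"
    by (rule card_image)
  have "\<not> have_common_edge E (?f x) (?f y)" if "x \<in> S" "y \<in> S" "?f x \<noteq> ?f y" for x y
  proof -
    obtain c l d r where xy: "x = (c, l)" "y = (d, r)"
      by (cases x, cases y)
    have "compatible E x y"
      using that by (intro comp) auto
    then show ?thesis
      using compatible_no_common_edge[of c l d r] xy by simp
  qed
  moreover have "?f ` S \<subseteq> E"
    using S by (auto simp: star_conflict_verts_def)
  ultimately show "edge_open_packing E (?f ` S)"
    unfolding edge_open_packing_def ball_simps by simp
qed

lemma packing_edge_leaf:
  assumes D: "edge_open_packing E D" and e: "e \<in> D"
  obtains c l where "e = {c, l}" "c \<noteq> l" "\<And>f. f \<in> D \<Longrightarrow> f \<noteq> e \<Longrightarrow> l \<notin> f"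
proof -
  have eE: "e \<in> E"
    using D e by (auto simp: edge_open_packing_def)
  then obtain u v where uv: "e = {u, v}" "u \<noteq> v"
    by (rule edgeE)
  have False if f: "f \<in> D" "f \<noteq> e" "u \<in> f" and g: "g \<in> D" "g \<noteq> e" "v \<in> g" for f g
  proof -
    have "f \<in> E"
      using D f by (auto simp: edge_open_packing_def)
    \<comment> \<open>An edge containing both \<open>u\<close> and \<open>v\<close> would be
      \<open>e\<close> itself.\<close>
    then have "v \<notin> f"
      using f uv by (elim edgeE) auto
    then have "f \<noteq> g"
      using g by blast
    \<comment> \<open>The common edge is \<open>e\<close>, running from \<open>u\<close> in
      \<open>f\<close> to \<open>v\<close> in \<open>g\<close>.\<close>
    moreover have "have_common_edge E f g"
      using eE f g uv unfolding have_common_edge_def by blast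
    ultimately show False
      using D f g unfolding edge_open_packing_def by blast
  qed
  then consider "\<And>f. f \<in> D \<Longrightarrow> f \<noteq> e \<Longrightarrow> v \<notin> f" | "\<And>f. f \<in> D \<Longrightarrow> f \<noteq> e \<Longrightarrow> u \<notin> f"
    by blast
  then show thesis
    using that[of u v] that[of v u] uv by (cases; blast)
qed

text \<open>The leaf conditions leave \<open>c = d\<close> as the only possible coincidence among
  the four vertices. If it occurs, \<open>{l, r}\<close> differs from both edges; otherwise all four
  cross pairs do. A pair differing from both edges would be a common edge if it lay in
  \<open>E\<close>.\<close>

lemma packing_compatible:
  assumes "\<not> have_common_edge E {c, l} {d, r}"
    and "c \<noteq> l" "d \<noteq> r" "l \<notin> {d, r}" "r \<notin> {c, l}"
  shows "compatible E (c, l) (d, r)"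
proof -
  have "{u, v} \<notin> E" if "u \<in> {c, l}" "v \<in> {d, r}" "{u, v} \<noteq> {c, l}" "{u, v} \<noteq> {d, r}" for u v
    using assms(1) that unfolding have_common_edge_def by blast
  then show ?thesis
    using assms(2-) by (auto simp: compatible_def doubleton_eq_iff)
qed

lemma packing_imp_indep:
  assumes D: "edge_open_packing E D"
  obtains S where "S \<subseteq> star_conflict_verts E" "indep S (star_conflict_edges E)" "card S = card D"
proof -
  have "\<forall>e \<in> D. \<exists>c l. e = {c, l} \<and> c \<noteq> l \<and> (\<forall>f \<in> D. f \<noteq> e \<longrightarrow> l \<notin> f)"
    using packing_edge_leaf[OF D] by metis
  \<comment> \<open>Choice fixes one orientation per packing edge, with head \<open>l e\<close> on
    no other edge of \<open>D\<close>.\<close>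
  then obtain c l where cl: "\<And>e. e \<in> D \<Longrightarrow> e = {c e, l e}" "\<And>e. e \<in> D \<Longrightarrow> c e \<noteq> l e"
    and leaf: "\<And>e f. e \<in> D \<Longrightarrow> f \<in> D \<Longrightarrow> f \<noteq> e \<Longrightarrow> l e \<notin> f"
    by metis
  let ?S = "(\<lambda>e. (c e, l e)) ` D"
  have comp: "compatible E (c e, l e) (c f, l f)" if "e \<in> D" "f \<in> D" "e \<noteq> f" for e f
  proof (rule packing_compatible)
    show "\<not> have_common_edge E {c e, l e} {c f, l f}"
      using D that cl(1) unfolding edge_open_packing_def by metis
    show "l e \<notin> {c f, l f}" "l f \<notin> {c e, l e}"
      using leaf that cl(1) by metis+
  qed (use that cl(2) in auto)
  have sub: "?S \<subseteq> star_conflict_verts E"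
  proof -
    have "{c e, l e} \<in> E" if "e \<in> D" for e
      using D that cl(1)[OF that] by (metis edge_open_packing_def subsetD)
    then show ?thesis
      by (auto simp: star_conflict_verts_def)
  qed
  moreover have "indep ?S (star_conflict_edges E)"
    unfolding indep_star_conflict_iff[OF sub] using comp by blast
  moreover have "card ?S = card D"
    \<comment> \<open>Orienting is injective because \<open>e\<close> is recovered as
      \<open>{c e, l e}\<close>.\<close>
    by (rule card_image, rule inj_onI) (metis cl(1) prod.inject)
  ultimately show thesis
    by (rule that)
qed

end

theorem lemma2:
  fixes V :: "'a set" and E :: "'a set set"
  assumes "simple_graph V E"
  shows "edge_open_packing_number E
    = independence_number (star_conflict_verts E) (star_conflict_edges E)"
proof -
  interpret simple_graph V E
    by (rule assms)
  \<comment> \<open>Both translations preserve cardinality exactly, so the two maxima are taken over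
    the same set of numbers.\<close>
  have "{card D | D. edge_open_packing E D} =
    {card S | S. S \<subseteq> star_conflict_verts E \<and> indep S (star_conflict_edges E)}"
    (is "?P = ?I")
  proof
    show "?P \<subseteq> ?I"
      using packing_imp_indep by (clarsimp, metis)
    show "?I \<subseteq> ?P"
      using indep_imp_packing by (clarsimp, metis)
  qed
  then show ?thesis
    by (simp add: edge_open_packing_number_def independence_number_def)
qed

end
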